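(* Let $(a_i)_{i\ge1}$ be a reversed prime Fibonacci sequence which is eventually monotonic. Then the set of its terms has asymptotic density zero in the primes, i.e. $\#\{i : a_i\le x\}/\pi(x)\to 0$ as $x\to\infty$, where $\pi(x)$ is the number of primes $\le x$.
   Context: Let $p,q$ be distinct odd primes. The reversed prime Fibonacci sequence generated by $p,q$ is the sequence $(a_i)_{i\ge1}$ with $a_1=p$, $a_2=q$, and for all $i\ge 1$, $a_{i+2}$ is the smallest odd prime with the property that $a_i$ is the smallest odd prime divisor of $a_{i+1}+a_{i+2}$. *)

theory Defs
  imports Complex_Main "HOL-Computational_Algebra.Primes"
begin

definition smallest :: "(nat \<Rightarrow> bool) \<Rightarrow> nat \<Rightarrow> bool" where
  "smallest P n \<longleftrightarrow> P n \<and> (\<forall>m. P m \<longrightarrow> n \<le> m)"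

definition odd_prime :: "nat \<Rightarrow> bool" where
  "odd_prime n \<longleftrightarrow> prime n \<and> odd n"

definition smallest_odd_prime_divisor :: "nat \<Rightarrow> nat \<Rightarrow> bool" where
  "smallest_odd_prime_divisor d n \<longleftrightarrow> smallest (\<lambda>r. odd_prime r \<and> r dvd n) d"

text \<open>Sequences are indexed from 1; the value \<open>a 0\<close> is unconstrained and never used.\<close>

definition reversed_prime_fibonacci :: "nat \<Rightarrow> nat \<Rightarrow> (nat \<Rightarrow> nat) \<Rightarrow> bool" where
  "reversed_prime_fibonacci p q a \<longleftrightarrow>
     odd_prime p \<and> odd_prime q \<and> p \<noteq> q \<and> a 1 = p \<and> a 2 = q \<and>
     (\<forall>i\<ge>1. smallest (\<lambda>r. odd_prime r \<and> smallest_odd_prime_divisor (a i) (a (i + 1) + r)) (a (i + 2)))"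

definition eventually_monotonic :: "(nat \<Rightarrow> nat) \<Rightarrow> bool" where
  "eventually_monotonic a \<longleftrightarrow> (\<exists>N\<ge>1. monoseq (\<lambda>i. a (N + i)))"

definition prime_count :: "real \<Rightarrow> nat" where
  "prime_count x = card {r::nat. prime r \<and> real r \<le> x}"

lemma reversed_prime_fibonacci_odd_prime:
  assumes "reversed_prime_fibonacci p q a" "i \<ge> 1"
  shows "odd_prime (a i)"
proof -
  consider "i = 1" | "i = 2" | j where "j \<ge> 1" "i = j + 2"
    using assms(2) by (metis One_nat_def Suc_1 add.commute add_2_eq_Suc le_add1 le_add_diff_inverse
        le_antisym not_less_eq_eq plus_1_eq_Suc)
  then show ?thesis
    using assms(1) by cases (auto simp: reversed_prime_fibonacci_def smallest_def)
qed

lemma reversed_prime_fibonacci_neq: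
  assumes "reversed_prime_fibonacci p q a" "i \<ge> 1"
  shows "a i \<noteq> a (Suc i)"
  using assms(2)
proof (induction i rule: dec_induct)
  case base
  then show ?case
    using assms(1) by (auto simp: reversed_prime_fibonacci_def numeral_2_eq_2)
next
  case (step i)
  have "smallest_odd_prime_divisor (a i) (a (i + 1) + a (i + 2))"
    using assms(1) step.hyps by (auto simp: reversed_prime_fibonacci_def smallest_def)
  then have d: "a i dvd a (Suc i) + a (Suc (Suc i))" and o: "odd_prime (a i)"
    by (auto simp: smallest_odd_prime_divisor_def smallest_def)
  have o': "odd_prime (a (Suc i))"
    using reversed_prime_fibonacci_odd_prime[OF assms(1), of "Suc i"] by simp
  show ?case
  proof
    assume "a (Suc i) = a (Suc (Suc i))"
    then have "a i dvd 2 * a (Suc i)"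
      using d by (simp add: mult_2)
    then have "a i dvd 2 \<or> a i dvd a (Suc i)"
      using o prime_dvd_mult_iff by (auto simp: odd_prime_def)
    then have "a i = 2 \<or> a i = a (Suc i)"
      using o o' by (auto simp: odd_prime_def primes_dvd_imp_eq)
    then show False
      using o step.IH by (auto simp: odd_prime_def)
  qed
qed

text \<open>This justifies counting indices with \<^const>\<open>card\<close>, which is 0 on infinite sets.\<close>

lemma reversed_prime_fibonacci_finite:
  assumes "reversed_prime_fibonacci p q a" "eventually_monotonic a"
  shows "finite {i. 1 \<le> i \<and> real (a i) \<le> x}"
proof -
  obtain N where N: "N \<ge> 1" "monoseq (\<lambda>i. a (N + i))"
    using assms(2) by (auto simp: eventually_monotonic_def)
  have ne: "a (N + i) \<noteq> a (N + Suc i)" for i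
    using reversed_prime_fibonacci_neq[OF assms(1), of "N + i"] N by simp
  from N(2) have "(\<forall>i. a (N + i) < a (N + Suc i)) \<or> (\<forall>i. a (N + Suc i) < a (N + i))"
    unfolding monoseq_Suc using ne by (metis le_neq_implies_less)
  then show ?thesis
  proof
    assume "\<forall>i. a (N + i) < a (N + Suc i)"
    then have "strict_mono (\<lambda>i. a (N + i))"
      by (simp add: strict_mono_Suc_iff)
    then have ge: "i \<le> a (N + i)" for i
      by (rule strict_mono_imp_increasing)
    have "i \<le> N + nat \<lfloor>x\<rfloor>" if "real (a i) \<le> x" for i
    proof (cases "i \<le> N")
      case False
      then have "i - N \<le> a i"
        using ge[of "i - N"] by simp
      moreover have "a i \<le> nat \<lfloor>x\<rfloor>"
        using that by (simp add: le_nat_floor)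
      ultimately show ?thesis by linarith
    qed simp
    then have "{i. 1 \<le> i \<and> real (a i) \<le> x} \<subseteq> {..N + nat \<lfloor>x\<rfloor>}"
      by auto
    then show ?thesis
      by (rule finite_subset) simp
  next
    assume *: "\<forall>i. a (N + Suc i) < a (N + i)"
    have "a (N + i) + i \<le> a N" for i
    proof (induction i)
      case (Suc i)
      then show ?case using *[rule_format, of i] by linarith
    qed simp
    from this[of "Suc (a N)"] show ?thesis by simp
  qed
qed

end

theory Submission
  imports Defs "HOL-Real_Asymp.Real_Asymp"
begin

text \<open>
  Once the sequence increases, \<open>a (i + 1) + a (i + 2)\<close> is a multiple of \<open>2 * a i\<close> exceeding
  \<open>2 * a i\<close>, hence at least \<open>4 * a i\<close>; so \<open>a (i + 2) > 2 * a i\<close> and only \<open>O(log x)\<close> terms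
  are below \<open>x\<close>. This is negligible against Chebyshev's lower bound \<open>x / log x\<close> for the number of
  primes, which follows from Nair's observation that \<open>m * (n choose m)\<close> divides every common
  multiple of \<open>1, \<dots>, n\<close>.
\<close>

section \<open>Chebyshev's lower bound for the number of primes\<close>

text \<open>The reciprocals of \<open>m * (n choose m)\<close> form Leibniz's harmonic triangle, whose entries
  are differences of neighbouring entries; \<open>m = 0\<close> is excluded as it gives \<open>1 / 0\<close>.\<close>

lemma leibniz_triangle_rec:
  assumes "1 \<le> m" "m < n"
  shows "1 / (real m * real (n choose m)) =
    1 / (real m * real ((n - 1) choose m)) - 1 / (real (Suc m) * real (n choose Suc m))"
proof -
  obtain k where n: "n = Suc k" and mk: "m \<le> k"
    using assms by (metis Suc_pred' less_Suc_eq_le less_nat_zero_code not_gr_zero)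
  \<comment> \<open>Both binomials of row \<open>n\<close> reduce to \<open>B\<close>: (m+1)
    C(n,m+1) = n B and (n-m) C(n,m) = n B. What remains is (n-m)/(m n) = 1/m - 1/n, divided by
    \<open>B\<close>.\<close>
  define B where "B = real (k choose m)"
  have B: "B > 0" using mk by (simp add: B_def)
  have e2: "real (Suc m) * real (n choose Suc m) = real n * B"
    using Suc_times_binomial_eq[of k m] unfolding n B_def
    by (metis mult.commute of_nat_mult)
  have "(n - m) * (n choose m) = n * (k choose m)"
    using binomial_absorb_comp[of n m] n by simp
  then have "real (n - m) * real (n choose m) = real n * B"
    unfolding B_def by (metis of_nat_mult)
  then have e1: "real (n choose m) = real n * B / (real n - real m)"
    using assms by (simp add: of_nat_diff field_simps)
  have "real m > 0" "real n > 0" "real n - real m > 0" using assms by auto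
  then have "1 / (real m * (real n * B / (real n - real m))) = 1 / (real m * B) - 1 / (real n * B)"
    using B by (simp add: divide_simps)
  then show ?thesis
    unfolding e2 unfolding e1 using n by (simp add: B_def)
qed

text \<open>\<open>D\<close> times every entry in the first \<open>n\<close> rows of Leibniz's
  triangle is an integer, by induction on rows and, within a row, downwards from its last entry 1/n:
  each other entry is the one above it minus its right neighbour.\<close>

lemma mult_binomial_dvd_common_multiple:
  fixes D :: nat
  assumes "\<And>k. 1 \<le> k \<Longrightarrow> k \<le> n \<Longrightarrow> k dvd D" "1 \<le> m" "m \<le> n"
  shows "m * (n choose m) dvd D"
proof -
  have "real D / (real m * real (n choose m)) \<in> \<int>"
    using assms
  proof (induction n arbitrary: m)
    case (Suc n)
    from Suc.prems(3,2) show ?case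
    proof (induction m rule: inc_induct)
      case base
      show ?case
        using real_of_nat_div[OF Suc.prems(1)[of "Suc n"]]
        by (metis Ints_of_nat One_nat_def Suc_le_mono binomial_n_n le_refl mult.right_neutral of_nat_1
            zero_le)
    next
      case (step m)
      have "real D / (real m * real (Suc n choose m)) =
        real D / (real m * real (n choose m)) - real D / (real (Suc m) * real (Suc n choose Suc m))"
        using arg_cong[OF leibniz_triangle_rec[of m "Suc n"], of "\<lambda>y. real D * y"] step
        by (simp add: right_diff_distrib del: of_nat_Suc binomial_Suc_Suc)
      moreover have "real D / (real m * real (n choose m)) \<in> \<int>"
        using Suc.prems(1) step by (intro Suc.IH) auto
      ultimately show ?case
        using step by (simp del: of_nat_Suc binomial_Suc_Suc)
    qed
  qed simp
  then obtain z :: int where z: "real D / real (m * (n choose m)) = of_int z"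
    by (auto elim: Ints_cases)
  have "m * (n choose m) > 0" using assms by simp
  then have "real D = of_int z * real (m * (n choose m))"
    using z by (simp add: field_simps)
  then have "int D = z * int (m * (n choose m))"
    by (metis of_int_eq_iff of_int_mult of_int_of_nat_eq)
  then have "int (m * (n choose m)) dvd int D"
    by (metis dvd_triv_right)
  then show ?thesis by presburger
qed

text \<open>The witness is the least common multiple of 1, ..., N, written as the product of the
  largest powers r^e \<le> N over the primes r \<le> N. There is one factor per prime and each is at
  most \<open>N\<close>.\<close>

lemma common_multiple_le_power_card_primes:
  fixes N :: nat
  obtains D where "D > 0" "\<And>k. 1 \<le> k \<Longrightarrow> k \<le> N \<Longrightarrow> k dvd D"
    "D \<le> N ^ card {r. prime r \<and> r \<le> N}"
proof
  define P where "P = {r. prime r \<and> r \<le> N}"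
  define e where "e r = (GREATEST k. r ^ k \<le> N)" for r :: nat
  have fin: "finite P" unfolding P_def by simp
  \<comment> \<open>Bounding the admissible exponents guarantees that the \<open>GREATEST\<close> in
    \<open>e\<close> is attained.\<close>
  have bound: "k \<le> N" if "prime r" "r ^ k \<le> N" for r k :: nat
  proof -
    have "k < 2 ^ k" by simp
    also have "(2::nat) ^ k \<le> r ^ k"
      using that prime_ge_2_nat by (intro power_mono) auto
    finally show ?thesis using that by simp
  qed
  have e1: "r ^ e r \<le> N" if "r \<in> P" for r
    unfolding e_def
    by (rule GreatestI_nat[where P = "\<lambda>k. r ^ k \<le> N" and k = 1 and b = N])
       (use that bound in \<open>auto simp: P_def\<close>)
  have e2: "k \<le> e r" if "r \<in> P" "r ^ k \<le> N" for r k
    unfolding e_def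
    by (rule Greatest_le_nat[where P = "\<lambda>k. r ^ k \<le> N" and b = N])
       (use that bound in \<open>auto simp: P_def\<close>)
  show "(\<Prod>r\<in>P. r ^ e r) > 0"
    by (intro prod_pos) (auto simp: P_def prime_gt_0_nat)
  show "k dvd (\<Prod>r\<in>P. r ^ e r)" if k: "1 \<le> k" "k \<le> N" for k
  proof -
    have subset: "prime_factors k \<subseteq> P"
    proof
      fix r assume "r \<in> prime_factors k"
      then have "r dvd k" "prime r" by auto
      then show "r \<in> P"
        using k dvd_imp_le[of r k] by (auto simp: P_def)
    qed
    have "k = (\<Prod>r\<in>prime_factors k. r ^ multiplicity r k)"
      using k by (simp add: prime_factorization_nat)
    also have "\<dots> dvd (\<Prod>r\<in>prime_factors k. r ^ e r)"
    proof (intro prod_dvd_prod le_imp_power_dvd e2)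
      fix r assume "r \<in> prime_factors k"
      then show "r \<in> P" using subset by blast
      show "r ^ multiplicity r k \<le> N"
        using k dvd_imp_le[OF multiplicity_dvd[of r k]] by simp
    qed
    also have "\<dots> dvd (\<Prod>r\<in>P. r ^ e r)"
      by (intro prod_dvd_prod_subset fin subset)
    finally show ?thesis .
  qed
  have "(\<Prod>r\<in>P. r ^ e r) \<le> (\<Prod>r\<in>P. N)"
    by (intro prod_mono) (auto simp: e1)
  then show "(\<Prod>r\<in>P. r ^ e r) \<le> N ^ card {r. prime r \<and> r \<le> N}"
    by (simp add: P_def)
qed

text \<open>The central entry \<open>m = n\<close> of row \<open>2 * n\<close> gives n C(2n,n) \<le>
  \<open>D\<close>. The factor \<open>n\<close> absorbs the one lost in 4^n/(2n) \<le> C(2n,n), so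
  only the constant 2 remains.\<close>

lemma four_power_le_power_card_primes:
  fixes n :: nat
  assumes "n > 0"
  shows "4 ^ n \<le> 2 * (2 * n) ^ card {r. prime r \<and> r \<le> 2 * n}"
proof -
  obtain D where D: "D > 0" "\<And>k. 1 \<le> k \<Longrightarrow> k \<le> 2 * n \<Longrightarrow> k dvd D"
    "D \<le> (2 * n) ^ card {r. prime r \<and> r \<le> 2 * n}"
    using common_multiple_le_power_card_primes[of "2 * n"] by blast
  have "n * ((2 * n) choose n) dvd D"
    using D assms by (intro mult_binomial_dvd_common_multiple) auto
  then have "n * ((2 * n) choose n) \<le> D"
    using D(1) dvd_imp_le by blast
  moreover have "4 ^ n / (2 * real n) \<le> real ((2 * n) choose n)"
    using assms by (rule central_binomial_lower_bound)
  then have "4 ^ n \<le> real (2 * (n * ((2 * n) choose n)))"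
    using assms by (simp add: field_simps)
  then have "4 ^ n \<le> 2 * (n * ((2 * n) choose n))"
    by (metis of_nat_le_iff of_nat_numeral of_nat_power)
  ultimately show ?thesis
    using D(3) by linarith
qed

text \<open>Take logarithms in the previous bound, with \<open>2 * n\<close> the largest even
  integer up to \<open>x\<close>. Rounding costs at most 2 and the constant factor costs 1 more,
  whence \<open>x - 3\<close>.\<close>

lemma prime_count_lower_bound:
  assumes "x \<ge> 4"
  shows "(x - 3) * ln 2 / ln x \<le> real (prime_count x)"
proof -
  define n where "n = nat \<lfloor>x\<rfloor> div 2"
  define c where "c = card {r. prime r \<and> r \<le> 2 * n}"
  have "2 * n \<le> nat \<lfloor>x\<rfloor>" "nat \<lfloor>x\<rfloor> \<le> 2 * n + 1" "nat \<lfloor>x\<rfloor> \<ge> 4"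
    using assms unfolding n_def by (auto simp: le_nat_floor)
  then have n: "real (2 * n) \<le> x" "x \<le> real (2 * n) + 2" "n > 0"
    by linarith+
  have "{r::nat. real r \<le> x} = {..nat \<lfloor>x\<rfloor>}"
    using assms by (auto simp: le_nat_floor) linarith
  then have fin: "finite {r::nat. real r \<le> x}" by simp
  have "c \<le> prime_count x"
    unfolding c_def prime_count_def
  proof (rule card_mono)
    show "finite {r::nat. prime r \<and> real r \<le> x}"
      by (rule finite_subset[OF _ fin]) auto
  qed (use n in auto)
  have "real (4 ^ n) \<le> real (2 * (2 * n) ^ c)"
    unfolding c_def of_nat_le_iff using n(3) by (rule four_power_le_power_card_primes)
  then have "ln (4 ^ n) \<le> ln (2 * real (2 * n) ^ c)"
    using n by simp
  then have "real n * ln 4 \<le> ln 2 + real c * ln (real (2 * n))"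
    using n by (simp add: ln_mult ln_realpow algebra_simps)
  moreover have "ln 4 = 2 * ln (2::real)"
    using ln_realpow[of 2 2] by simp
  ultimately have "(real (2 * n) - 1) * ln 2 \<le> real c * ln (real (2 * n))"
    by (simp add: algebra_simps)
  moreover have "(x - 3) * ln 2 \<le> (real (2 * n) - 1) * ln 2"
    using n by (intro mult_right_mono) auto
  moreover have "real c * ln (real (2 * n)) \<le> real (prime_count x) * ln x"
    using n \<open>c \<le> prime_count x\<close> by (intro mult_mono) auto
  ultimately have "(x - 3) * ln 2 \<le> real (prime_count x) * ln x" by linarith
  then show ?thesis
    using assms by (simp add: field_simps)
qed

section \<open>Exponential growth of the sequence\<close>

lemma reversed_prime_fibonacci_doubling:
  assumes "reversed_prime_fibonacci p q a" "i \<ge> 1"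
    and "a i < a (i + 1)" "a (i + 1) < a (i + 2)"
  shows "2 * a i < a (i + 2)"
proof -
  have "smallest_odd_prime_divisor (a i) (a (i + 1) + a (i + 2))"
    using assms(1,2) by (auto simp: reversed_prime_fibonacci_def smallest_def)
  then have dvd: "a i dvd a (i + 1) + a (i + 2)"
    by (auto simp: smallest_odd_prime_divisor_def smallest_def)
  have odd: "odd (a j)" if "j \<ge> 1" for j
    using reversed_prime_fibonacci_odd_prime[OF assms(1) that] by (simp add: odd_prime_def)
  have "2 dvd a (i + 1) + a (i + 2)"
    using odd[of "i + 1"] odd[of "i + 2"] by simp
  moreover have "coprime 2 (a i)"
    using odd[OF assms(2)] by simp
  ultimately have "2 * a i dvd a (i + 1) + a (i + 2)"
    using dvd by (simp add: divides_mult)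
  then obtain t where t: "a (i + 1) + a (i + 2) = 2 * a i * t" by (elim dvdE)
  have "t \<ge> 2"
  proof (rule ccontr)
    \<comment> \<open>Both summands exceed \<open>a i\<close>, so their sum cannot be at most
      \<open>2 * a i\<close>.\<close>
    assume "\<not> t \<ge> 2"
    then have "2 * a i * t \<le> 2 * a i * 1" by (intro mult_left_mono) auto
    then show False using t assms(3,4) by linarith
  qed
  then have "2 * a i * 2 \<le> a (i + 1) + a (i + 2)"
    unfolding t by (intro mult_left_mono) auto
  \<comment> \<open>The larger summand \<open>a (i + 2)\<close> exceeds half of the sum.\<close>
  then show ?thesis using assms(4) by linarith
qed

text \<open>Neighbouring terms differ, so a monotonic tail is strict, and a strictly decreasing one
  would descend forever in the naturals.\<close>

lemma reversed_prime_fibonacci_eventually_increasing: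
  assumes "reversed_prime_fibonacci p q a" "eventually_monotonic a"
  obtains N where "N \<ge> 1" "\<And>i. i \<ge> N \<Longrightarrow> a i < a (i + 1)"
proof -
  obtain N where N: "N \<ge> 1" "monoseq (\<lambda>i. a (N + i))"
    using assms(2) by (auto simp: eventually_monotonic_def)
  have ne: "a (N + i) \<noteq> a (N + Suc i)" for i
    using reversed_prime_fibonacci_neq[OF assms(1), of "N + i"] N by simp
  from N(2) have "(\<forall>i. a (N + i) < a (N + Suc i)) \<or> (\<forall>i. a (N + Suc i) < a (N + i))"
    unfolding monoseq_Suc using ne by (metis le_neq_implies_less)
  moreover have "\<not> (\<forall>i. a (N + Suc i) < a (N + i))"
    using wf_less_than[unfolded wf_iff_no_infinite_down_chain]
    by (auto dest!: spec[of _ "\<lambda>i. a (N + i)"])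
  ultimately have "\<forall>i. a (N + i) < a (N + Suc i)" by blast
  then have "a i < a (i + 1)" if "i \<ge> N" for i
    using that by (metis Suc_eq_plus1 add_Suc_right le_Suc_ex)
  then show ?thesis using that N(1) by blast
qed

lemma reversed_prime_fibonacci_card_bound:
  assumes "reversed_prime_fibonacci p q a" "eventually_monotonic a"
  obtains C :: real where
    "\<And>x. x \<ge> 1 \<Longrightarrow> real (card {i. 1 \<le> i \<and> real (a i) \<le> x}) \<le> C + 2 * log 2 x"
proof -
  obtain N where N: "N \<ge> 1" "\<And>i. i \<ge> N \<Longrightarrow> a i < a (i + 1)"
    using reversed_prime_fibonacci_eventually_increasing[OF assms] by blast
  have double: "2 * a i < a (i + 2)" if "i \<ge> N" for i
    using that N reversed_prime_fibonacci_doubling[OF assms(1), of i] N(2)[of "i + 1"]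
    by (simp add: numeral_2_eq_2)
  have growth: "2 ^ j \<le> a (i + 2 * j)" if "i \<ge> N" for i j
  proof (induction j)
    case 0
    have "prime (a i)"
      using that N(1) reversed_prime_fibonacci_odd_prime[OF assms(1), of i]
      by (simp add: odd_prime_def)
    then show ?case using prime_ge_1_nat by auto
  next
    case (Suc j)
    then show ?case using double[of "i + 2 * j"] that by (simp add: algebra_simps)
  qed
  have "real (card {i. 1 \<le> i \<and> real (a i) \<le> x}) \<le> real (N + 1) + 2 * log 2 x"
    if x: "x \<ge> 1" for x
  proof -
    have "i \<le> N + 1 + nat \<lfloor>2 * log 2 x\<rfloor>" if i: "real (a i) \<le> x" for i
    proof (cases "i \<le> N + 1")
      case False
      \<comment> \<open>Going back \<open>j\<close> double steps from \<open>i\<close> ends at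
        \<open>N\<close> or \<open>N + 1\<close>, according to parity; \<open>growth\<close> applies
        from either.\<close>
      define j where "j = (i - N) div 2"
      have j: "N \<le> i - 2 * j" "i - 2 * j \<le> N + 1" "2 * j \<le> i"
        unfolding j_def using False by linarith+
      have "2 ^ j \<le> a i"
        using growth[OF j(1), of j] j(3) by simp
      then have "real (2 ^ j) \<le> real (a i)"
        by (simp only: of_nat_le_iff)
      then have "2 ^ j \<le> real (a i)"
        by (simp only: of_nat_power of_nat_numeral)
      with i have "2 ^ j \<le> x" by linarith
      then have "real j \<le> log 2 x"
        using x by (simp add: le_log_iff powr_realpow)
      then have "2 * j \<le> nat \<lfloor>2 * log 2 x\<rfloor>"
        by (intro le_nat_floor) simp
      then show ?thesis using j by linarith
    qed simp
    then have "{i. 1 \<le> i \<and> real (a i) \<le> x} \<subseteq> {1..N + 1 + nat \<lfloor>2 * log 2 x\<rfloor>}"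
      by auto
    from card_mono[OF finite_atLeastAtMost this]
    have "card {i. 1 \<le> i \<and> real (a i) \<le> x} \<le> N + 1 + nat \<lfloor>2 * log 2 x\<rfloor>"
      by (simp only: card_atLeastAtMost)
    \<comment> \<open>The sign matters: on negative reals \<open>nat\<close> of the floor is 0,
      which exceeds the argument.\<close>
    moreover have "log 2 x \<ge> 0" using x by simp
    then have "real (nat \<lfloor>2 * log 2 x\<rfloor>) \<le> 2 * log 2 x" by simp
    ultimately show ?thesis by linarith
  qed
  then show ?thesis using that by blast
qed

section \<open>Comparison of the two counts\<close>

theorem theorem3p2:
  fixes p q :: nat and a :: "nat \<Rightarrow> nat"
  assumes "reversed_prime_fibonacci p q a"
    and "eventually_monotonic a"
  shows "((\<lambda>x::real. real (card {i. 1 \<le> i \<and> real (a i) \<le> x}) / real (prime_count x))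
           \<longlongrightarrow> 0) at_top"
proof -
  obtain C :: real where C:
    "\<And>x. x \<ge> 1 \<Longrightarrow> real (card {i. 1 \<le> i \<and> real (a i) \<le> x}) \<le> C + 2 * log 2 x"
    using reversed_prime_fibonacci_card_bound[OF assms] by blast
  show ?thesis
  proof (rule tendsto_sandwich[where f = "\<lambda>_. 0"])
    \<comment> \<open>The upper envelope is of order (log x)^2 / x.\<close>
    show "((\<lambda>x::real. (C + 2 * log 2 x) / ((x - 3) * ln 2 / ln x)) \<longlongrightarrow> 0) at_top"
      by real_asymp
    show "\<forall>\<^sub>F x in at_top. real (card {i. 1 \<le> i \<and> real (a i) \<le> x}) / real (prime_count x)
        \<le> (C + 2 * log 2 x) / ((x - 3) * ln 2 / ln x)"
      using eventually_ge_at_top[of 4]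
    proof eventually_elim
      case (elim x)
      have "(x - 3) * ln 2 / ln x > 0" using elim by simp
      \<comment> \<open>The numerator bound dominates a cardinality, hence is nonnegative, as
        \<open>frac_le\<close> requires.\<close>
      moreover have "C + 2 * log 2 x \<ge> 0" using C[of x] elim by linarith
      ultimately show ?case
        using C[of x] prime_count_lower_bound[OF elim] elim by (intro frac_le) auto
    qed
  qed (auto intro!: always_eventually)
qed

end
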